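(* Let $\alpha\ge1$. There exists a constant $C_\alpha>0$ depending only on $\alpha$ such that the following holds. If $X_1,\ldots,X_n$ are independent mean zero real-valued random variables with $\|X_i\|_{\psi_\alpha}<\infty$ for all $1\le i\le n$ and $\sum_{i=1}^n\mathbb{E}[X_i^2]>0$, then $$\Big\|\sum_{i=1}^nX_i\Big\|_{\Psi_{1,L_n(\alpha)}}\le2e\sqrt6\Big(\sum_{i=1}^n\mathbb{E}[X_i^2]\Big)^{1/2},$$ where $$L_n(\alpha):=\frac{4^{1/\alpha}C_\alpha}{2\sqrt6}(\log(n+1))^{1/\alpha}\Big(\sum_{i=1}^n\mathbb{E}[X_i^2]\Big)^{-1/2}\max_{1\le i\le n}\|X_i\|_{\psi_\alpha}.$$
   Context: For a non-decreasing $g:[0,\infty)\to[0,\infty)$ with $g(0)=0$, the $g$-Orlicz norm of a real random variable $X$ is $\|X\|_g:=\inf\{\eta>0:\mathbb{E}[g(|X|/\eta)]\le1\}$. For $\alpha>0$, $\psi_\alpha(x):=\exp(x^\alpha)-1$, $x\ge0$. For $L\ge0$, the function $\Psi_{1,L}:[0,\infty)\to[0,\infty)$ is defined through its inverse $\Psi_{1,L}^{-1}(t):=\sqrt{\log(1+t)}+L\log(1+t)$, $t\ge0$, and $\|X\|_{\Psi_{1,L}}$ is the $g$-Orlicz norm with $g=\Psi_{1,L}$. *)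

theory Defs
  imports "HOL-Probability.Probability"
begin

text \<open>
  The norm is \<open>\<infinity>\<close> if no \<open>\<eta>\<close> is admissible. The expectation is a Lebesgue integral of a nonnegative
  function, so it may be infinite as well. Only the values of \<open>g\<close> on \<open>[0, \<infinity>)\<close> matter.
\<close>

definition orlicz_norm :: "(real \<Rightarrow> real) \<Rightarrow> 'a measure \<Rightarrow> ('a \<Rightarrow> real) \<Rightarrow> ennreal" where
  "orlicz_norm g M X =
     (INF \<eta> \<in> {\<eta>::real. \<eta> > 0 \<and> (\<integral>\<^sup>+ \<omega>. ennreal (g (\<bar>X \<omega>\<bar> / \<eta>)) \<partial>M) \<le> 1}. ennreal \<eta>)"

definition psi :: "real \<Rightarrow> real \<Rightarrow> real" where
  "psi \<alpha> x = exp (x powr \<alpha>) - 1"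

definition Psi1_inv :: "real \<Rightarrow> real \<Rightarrow> real" where
  "Psi1_inv L t = sqrt (ln (1 + t)) + L * ln (1 + t)"

definition Psi1 :: "real \<Rightarrow> real \<Rightarrow> real" where
  "Psi1 L = inv_into {0..} (Psi1_inv L)"

lemma strict_mono_on_Psi1_inv:
  assumes "L \<ge> 0"
  shows "strict_mono_on {0..} (Psi1_inv L)"
proof (rule strict_mono_onI)
  fix s t :: real
  assume "s \<in> {0..}" "t \<in> {0..}" "s < t"
  then have "ln (1 + s) < ln (1 + t)" by simp
  then show "Psi1_inv L s < Psi1_inv L t"
    unfolding Psi1_inv_def using assms
    by (intro add_less_le_mono mult_left_mono) auto
qed

lemma bij_betw_Psi1_inv:
  assumes "L \<ge> 0"
  shows "bij_betw (Psi1_inv L) {0..} {0..}"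
  unfolding bij_betw_def
proof
  show "inj_on (Psi1_inv L) {0..}"
    using strict_mono_on_Psi1_inv[OF assms] by (rule strict_mono_on_imp_inj_on)
  show "Psi1_inv L ` {0..} = {0..}"
  proof (intro equalityI subsetI)
    fix x assume "x \<in> Psi1_inv L ` {0..}"
    then show "x \<in> {0..}" using assms by (auto simp: Psi1_inv_def)
  next
    fix x :: real assume x: "x \<in> {0..}"
    define b where "b = exp (x\<^sup>2) - 1"
    have b: "b \<ge> 0" by (simp add: b_def)
    have "x \<le> Psi1_inv L b" using x assms by (simp add: b_def Psi1_inv_def)
    moreover have "Psi1_inv L 0 \<le> x" using x by (simp add: Psi1_inv_def)
    moreover have "continuous_on {0..b} (Psi1_inv L)"
      unfolding Psi1_inv_def by (intro continuous_intros) auto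
    ultimately obtain t where "0 \<le> t" "Psi1_inv L t = x"
      using IVT'[of "Psi1_inv L" 0 x b] b by auto
    then show "x \<in> Psi1_inv L ` {0..}" by force
  qed
qed

lemma Psi1_0:
  assumes "L \<ge> 0"
  shows "Psi1 L 0 = 0"
proof -
  have "Psi1_inv L 0 = 0" by (simp add: Psi1_inv_def)
  moreover have "inv_into {0..} (Psi1_inv L) (Psi1_inv L 0) = 0"
    using bij_betw_Psi1_inv[OF assms] by (intro inv_into_f_f) (auto simp: bij_betw_def)
  ultimately show ?thesis by (simp add: Psi1_def)
qed

definition L_const :: "real \<Rightarrow> real \<Rightarrow> 'a measure \<Rightarrow> nat \<Rightarrow> (nat \<Rightarrow> 'a \<Rightarrow> real) \<Rightarrow> real" where
  "L_const \<alpha> C M n X =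
     4 powr (1 / \<alpha>) * C / (2 * sqrt 6) * ln (real n + 1) powr (1 / \<alpha>)
     * (\<Sum>i = 1..n. \<integral>\<omega>. (X i \<omega>)\<^sup>2 \<partial>M) powr (- 1 / 2)
     * (MAX i \<in> {1..n}. enn2real (orlicz_norm (psi \<alpha>) M (X i)))"

text \<open>
  \<open>C\<close> is an admissible constant \<open>C\<^sub>\<alpha>\<close> for all probability spaces on the type \<open>'a\<close>, all \<open>n\<close> and all
  \<open>X\<^sub>1, \<dots>, X\<^sub>n\<close>. Note that \<open>n > 0\<close> follows from positivity of the sum of second moments.
\<close>

definition admissible_const :: "'a itself \<Rightarrow> real \<Rightarrow> real \<Rightarrow> bool" where
  "admissible_const (_ :: 'a itself) \<alpha> C \<longleftrightarrow>
     (\<forall>(M :: 'a measure) n X.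
        prob_space M \<longrightarrow>
        prob_space.indep_vars M (\<lambda>_. borel) X {1..n} \<longrightarrow>
        (\<forall>i\<in>{1..n}. integrable M (X i) \<and> (\<integral>\<omega>. X i \<omega> \<partial>M) = 0) \<longrightarrow>
        (\<forall>i\<in>{1..n}. orlicz_norm (psi \<alpha>) M (X i) < \<infinity>) \<longrightarrow>
        (\<Sum>i = 1..n. \<integral>\<omega>. (X i \<omega>)\<^sup>2 \<partial>M) > 0 \<longrightarrow>
        orlicz_norm (Psi1 (L_const \<alpha> C M n X)) M (\<lambda>\<omega>. \<Sum>i = 1..n. X i \<omega>)
          \<le> ennreal (2 * exp 1 * sqrt 6 * sqrt (\<Sum>i = 1..n. \<integral>\<omega>. (X i \<omega>)\<^sup>2 \<partial>M)))"

text \<open>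
  The constant may depend on \<open>\<alpha>\<close> only, hence not on the type of the sample space. As HOL cannot
  quantify over types below an existential, \<open>\<exists>C>0. admissible_const TYPE('a) \<alpha> C\<close> would allow
  \<open>C\<close> to vary with \<open>'a\<close>. Uniformity is expressed instead by one fixed type that can carry the joint
  law of every finite family of real random variables: some \<open>C > 0\<close> is admissible for
  \<^typ>\<open>nat \<Rightarrow> real\<close>, and every such \<open>C\<close> is admissible for every \<open>'a\<close>.
\<close>

end

theory Submission
  imports Defs
begin

text \<open>
  The bound follows from a local sub-Gaussian estimate of the moment generating function of the sum
  \<open>S\<close>: if \<open>E exp(\<mu> S) \<le> 2 exp(\<mu>\<^sup>2 \<sigma>\<^sup>2)\<close> for \<open>\<bar>\<mu>\<bar> \<le> 1/B\<close>, then Chernoff's bound with a suitable \<open>\<mu>\<close> gives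
  a Gaussian tail followed by an exponential tail of scale \<open>B\<close>. The inverse of \<open>\<Psi>\<^sub>1\<^sub>,\<^sub>L\<close> is, up to scale, the
  quantile function of exactly such a tail, and integrating the tail bounds the Orlicz norm
  (\<open>orlicz_norm_Psi1_le\<close>).

  The difficulty is to get the true variance in the Gaussian part although the \<open>X\<^sub>i\<close> are unbounded.
  With \<open>K\<close> above the \<open>\<psi>\<^sub>\<alpha>\<close>-norms, let \<open>B = K l powr (1/\<alpha>)\<close> and \<open>u = \<mu> X\<^sub>i\<close>. Where \<open>\<bar>X\<^sub>i\<bar> \<le> B\<close> one has
  \<open>\<bar>u\<bar> \<le> 1\<close> and \<open>exp u \<le> 1 + u + u\<^sup>2\<close>, which produces only the second moment. Where \<open>\<bar>X\<^sub>i\<bar> > B\<close>, the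
  hypothesis \<open>\<alpha> \<ge> 1\<close> makes \<open>exp (\<bar>X\<^sub>i\<bar>/B)\<close> smaller than \<open>exp ((\<bar>X\<^sub>i\<bar>/K)\<^sup>\<alpha>)\<close> by a factor \<open>exp (l - 1)\<close>, so
  this part contributes at most \<open>2 exp (1 - l)\<close> (\<open>exp_le_quadratic_plus_tail\<close>, \<open>mgf_le\<close>). With
  \<open>l = 8 log (n + 1)\<close> these contributions stay bounded over all \<open>n\<close> summands and are absorbed by the
  factor 2 in front of the exponential (\<open>mgf_sum_le\<close>). Hence
  \<open>4 * 2 powr (1/\<alpha>)\<close> is an admissible constant on every sample space.

  That an admissible constant for \<open>nat \<Rightarrow> real\<close> is admissible everywhere holds because the hypotheses
  and the conclusion depend only on the joint law of \<open>X\<^sub>1, \<dots>, X\<^sub>n\<close>, which lives on that type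
  (\<open>admissible_const_transfer\<close>).
\<close>

section \<open>Orlicz functions and norms\<close>

lemma psi_mono:
  assumes "0 \<le> x" "x \<le> y" "\<alpha> \<ge> 0"
  shows "psi \<alpha> x \<le> psi \<alpha> y"
  unfolding psi_def using powr_mono2[of \<alpha> x y] assms by simp

lemma Psi1_nonneg:
  assumes "L \<ge> 0" "x \<ge> 0"
  shows "Psi1 L x \<ge> 0"
  using bij_betw_apply[OF bij_betw_inv_into[OF bij_betw_Psi1_inv[OF assms(1)]], of x] assms(2)
  by (auto simp: Psi1_def)

lemma Psi1_inv_Psi1:
  assumes "L \<ge> 0" "x \<ge> 0"
  shows "Psi1_inv L (Psi1 L x) = x"
  using bij_betw_inv_into_right[OF bij_betw_Psi1_inv[OF assms(1)], of x] assms(2)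
  by (simp add: Psi1_def)

lemma less_Psi1_iff:
  assumes "L \<ge> 0" "x \<ge> 0" "t \<ge> 0"
  shows "t < Psi1 L x \<longleftrightarrow> Psi1_inv L t < x"
  using strict_mono_on_less[OF strict_mono_on_Psi1_inv[OF assms(1)], of t "Psi1 L x"]
    Psi1_nonneg[OF assms(1,2)] Psi1_inv_Psi1[OF assms(1,2)] assms(3) by simp

lemma Psi1_mono:
  assumes "L \<ge> 0" "0 \<le> x" "x \<le> y"
  shows "Psi1 L x \<le> Psi1 L y"
  using less_Psi1_iff[of L x "Psi1 L y"] Psi1_inv_Psi1[of L y] Psi1_nonneg[of L y] assms by auto

lemma borel_measurable_mono_abs:
  fixes g :: "real \<Rightarrow> real"
  assumes "\<And>x y. 0 \<le> x \<Longrightarrow> x \<le> y \<Longrightarrow> g x \<le> g y"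
  shows "(\<lambda>x. g \<bar>x\<bar>) \<in> borel_measurable borel"
proof -
  have "mono (\<lambda>x. g (max 0 x))"
    by (intro monoI assms) auto
  then have [measurable]: "(\<lambda>x. g (max 0 x)) \<in> borel_measurable borel"
    by (rule borel_measurable_mono)
  have "(\<lambda>x. g (max 0 \<bar>x\<bar>)) \<in> borel_measurable borel"
    by measurable
  then show ?thesis by simp
qed

lemma orlicz_norm_le:
  assumes "\<eta> > 0" "(\<integral>\<^sup>+ \<omega>. ennreal (g (\<bar>X \<omega>\<bar> / \<eta>)) \<partial>M) \<le> 1"
  shows "orlicz_norm g M X \<le> ennreal \<eta>"
  unfolding orlicz_norm_def using assms by (intro INF_lower) auto

text \<open>
  The infimum in the norm need not be attained for a general \<open>g\<close>, but monotonicity makes every scale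
  strictly above it admissible. All later uses therefore work with a strict bound on the norm.
\<close>

lemma nn_integral_le_1_of_orlicz_norm_less:
  assumes "orlicz_norm g M X < ennreal K"
    and mono: "\<And>x y. 0 \<le> x \<Longrightarrow> x \<le> y \<Longrightarrow> g x \<le> g y"
  shows "(\<integral>\<^sup>+ \<omega>. ennreal (g (\<bar>X \<omega>\<bar> / K)) \<partial>M) \<le> 1"
proof -
  from assms(1) obtain \<eta> where \<eta>: "\<eta> > 0" "ennreal \<eta> < ennreal K"
    "(\<integral>\<^sup>+ \<omega>. ennreal (g (\<bar>X \<omega>\<bar> / \<eta>)) \<partial>M) \<le> 1"
    unfolding orlicz_norm_def by (auto simp: INF_less_iff)
  then have "\<eta> < K" by (simp add: ennreal_less_iff)
  then have "(\<integral>\<^sup>+ \<omega>. ennreal (g (\<bar>X \<omega>\<bar> / K)) \<partial>M) \<le> (\<integral>\<^sup>+ \<omega>. ennreal (g (\<bar>X \<omega>\<bar> / \<eta>)) \<partial>M)"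
    using \<eta>(1) by (intro nn_integral_mono ennreal_leI mono) (auto intro!: divide_left_mono)
  also note \<eta>(3)
  finally show ?thesis .
qed

lemma orlicz_norm_distr:
  assumes [measurable]: "F \<in> measurable M N" "Y \<in> borel_measurable N"
    and g [measurable]: "(\<lambda>x. g \<bar>x\<bar>) \<in> borel_measurable borel"
  shows "orlicz_norm g (distr M N F) Y = orlicz_norm g M (\<lambda>\<omega>. Y (F \<omega>))"
proof -
  have "(\<integral>\<^sup>+ \<omega>. ennreal (g (\<bar>Y \<omega>\<bar> / \<eta>)) \<partial>distr M N F)
      = (\<integral>\<^sup>+ \<omega>. ennreal (g (\<bar>Y (F \<omega>)\<bar> / \<eta>)) \<partial>M)" if "\<eta> > 0" for \<eta>
  proof -
    have "(\<lambda>\<omega>. g \<bar>Y \<omega> / \<eta>\<bar>) \<in> borel_measurable N"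
      by (rule measurable_compose[OF _ g]) measurable
    then have [measurable]: "(\<lambda>\<omega>. g (\<bar>Y \<omega>\<bar> / \<eta>)) \<in> borel_measurable N"
      using that by simp
    show ?thesis by (subst nn_integral_distr) auto
  qed
  then show ?thesis unfolding orlicz_norm_def by (intro INF_cong) auto
qed

section \<open>The norm bound from the moment generating function\<close>

text \<open>
  Tonelli, applied to \<open>max 0 (f \<omega>)\<close> written as the length of \<open>[0, f \<omega>)\<close>.
\<close>

lemma nn_integral_layer_cake:
  assumes "sigma_finite_measure M" and [measurable]: "f \<in> borel_measurable M"
  shows "(\<integral>\<^sup>+ \<omega>. ennreal (f \<omega>) \<partial>M)
       = (\<integral>\<^sup>+ t. emeasure M {\<omega> \<in> space M. t < f \<omega>} * indicator {0..} t \<partial>lborel)"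
proof -
  interpret M: sigma_finite_measure M by fact
  interpret pair_sigma_finite M lborel by unfold_locales
  have "(\<integral>\<^sup>+ \<omega>. ennreal (f \<omega>) \<partial>M) = (\<integral>\<^sup>+ \<omega>. \<integral>\<^sup>+ t. indicator {0..<f \<omega>} t \<partial>lborel \<partial>M)"
  proof (intro nn_integral_cong)
    show "ennreal (f \<omega>) = (\<integral>\<^sup>+ t. indicator {0..<f \<omega>} t \<partial>lborel)" for \<omega>
      by (cases "f \<omega> \<ge> 0") (auto simp: ennreal_neg)
  qed
  also have "\<dots> = (\<integral>\<^sup>+ \<omega>. \<integral>\<^sup>+ t. (if 0 \<le> t \<and> t < f \<omega> then 1 else 0) \<partial>lborel \<partial>M)"
    by (intro nn_integral_cong) (auto simp: indicator_def)
  also have "\<dots> = (\<integral>\<^sup>+ t. \<integral>\<^sup>+ \<omega>. (if 0 \<le> t \<and> t < f \<omega> then 1 else 0) \<partial>M \<partial>lborel)"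
    by (rule Fubini'[symmetric]) measurable
  also have "\<dots> = (\<integral>\<^sup>+ t. emeasure M {\<omega> \<in> space M. t < f \<omega>} * indicator {0..} t \<partial>lborel)"
  proof (intro nn_integral_cong)
    fix t :: real
    have "(\<integral>\<^sup>+ \<omega>. (if 0 \<le> t \<and> t < f \<omega> then 1 else 0) \<partial>M)
        = (\<integral>\<^sup>+ \<omega>. indicator {0..} t * indicator {\<omega> \<in> space M. t < f \<omega>} \<omega> \<partial>M)"
      by (intro nn_integral_cong) (auto simp: indicator_def)
    also have "\<dots> = indicator {0..} t * emeasure M {\<omega> \<in> space M. t < f \<omega>}"
      by (subst nn_integral_cmult_indicator) auto
    finally show "(\<integral>\<^sup>+ \<omega>. (if 0 \<le> t \<and> t < f \<omega> then 1 else 0) \<partial>M)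
        = emeasure M {\<omega> \<in> space M. t < f \<omega>} * indicator {0..} t"
      by (simp add: mult.commute)
  qed
  finally show ?thesis .
qed

lemma nn_integral_inverse_fifth_power:
  "(\<integral>\<^sup>+ t. ennreal (4 / (1 + t) ^ 5) * indicator {0..} t \<partial>lborel) = 1"
proof -
  have "(\<integral>\<^sup>+ t. ennreal (4 / (1 + t) ^ 5) * indicator {0..} t \<partial>lborel)
      = ennreal (0 - (- 1 / (1 + 0) ^ 4))"
  proof (rule nn_integral_FTC_atLeast)
    show "((\<lambda>t::real. - 1 / (1 + t) ^ 4) \<longlongrightarrow> 0) at_top"
      by (intro tendsto_divide_0[OF tendsto_const] filterlim_at_top_imp_at_infinity
          filterlim_pow_at_top filterlim_tendsto_add_at_top[OF tendsto_const] filterlim_ident) auto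
    show "DERIV (\<lambda>t. - 1 / (1 + t) ^ 4) x :> 4 / (1 + x) ^ 5" if "0 \<le> x" for x :: real
      using that by (auto intro!: derivative_eq_intros simp: divide_simps eval_nat_numeral)
  qed auto
  then show ?thesis by simp
qed

lemma exp_1_ge: "5 / 2 \<le> exp (1::real)"
  using exp_lower_Taylor_quadratic[of 1] by simp

text \<open>
  The choice of the Chernoff parameter. The unconstrained choice \<open>\<mu> = sqrt s / \<sigma>\<close> makes
  \<open>\<mu>\<^sup>2 \<sigma>\<^sup>2 = s\<close> and is paid for by the Gaussian term \<open>\<eta> sqrt s\<close>. If it exceeds \<open>1/B\<close>, then at \<open>\<mu> = 1/B\<close>
  the Gaussian term still cancels \<open>\<mu>\<^sup>2 \<sigma>\<^sup>2\<close>, and the linear term \<open>\<eta> L s\<close> alone supplies the decay \<open>5 s\<close>.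
\<close>

lemma sub_gamma_exponent:
  fixes \<sigma> B s \<eta> L :: real
  assumes "\<sigma> > 0" "B > 0" "s \<ge> 0" "L \<ge> 0" "\<eta> \<ge> 6 * \<sigma>" "\<eta> * L \<ge> 5 * B"
  shows "\<exists>\<mu>\<ge>0. \<mu> \<le> 1 / B \<and> \<mu>\<^sup>2 * \<sigma>\<^sup>2 - \<mu> * (\<eta> * (sqrt s + L * s)) \<le> - 5 * s"
proof (cases "sqrt s / \<sigma> \<le> 1 / B")
  case True
  define \<mu> where "\<mu> = sqrt s / \<sigma>"
  have "\<mu> \<ge> 0" using assms by (simp add: \<mu>_def)
  have *: "\<mu> * \<sigma> = sqrt s" using assms by (simp add: \<mu>_def)
  have "\<mu>\<^sup>2 * \<sigma>\<^sup>2 = s" using * assms by (simp flip: power_mult_distrib)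
  moreover have "\<mu> * (\<eta> * (sqrt s + L * s)) \<ge> \<mu> * (6 * \<sigma> * sqrt s)"
  proof (intro mult_left_mono \<open>\<mu> \<ge> 0\<close>)
    have "\<eta> * sqrt s \<ge> 6 * \<sigma> * sqrt s" using assms by (intro mult_right_mono) auto
    moreover have "\<eta> * L * s \<ge> 0" using assms by (intro mult_nonneg_nonneg) auto
    ultimately show "6 * \<sigma> * sqrt s \<le> \<eta> * (sqrt s + L * s)" by (simp add: algebra_simps)
  qed
  moreover have "\<mu> * (6 * \<sigma> * sqrt s) = 6 * s"
    using * assms by (metis (no_types, opaque_lifting) mult.assoc mult.left_commute real_sqrt_mult_self abs_of_nonneg)
  ultimately show ?thesis using True \<open>\<mu> \<ge> 0\<close> unfolding \<mu>_def[symmetric] by (intro exI[of _ \<mu>]) auto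
next
  case False
  then have *: "\<sigma> / B \<le> sqrt s" using assms by (simp add: field_simps)
  have "(1/B)\<^sup>2 * \<sigma>\<^sup>2 = (\<sigma> / B) * (\<sigma> / B)" by (simp add: power2_eq_square)
  also have "\<dots> \<le> (\<sigma> / B) * sqrt s" using * assms by (intro mult_left_mono) auto
  also have "\<dots> \<le> (\<eta> / B) * sqrt s" using assms by (intro mult_right_mono divide_right_mono) auto
  finally have 1: "(1/B)\<^sup>2 * \<sigma>\<^sup>2 \<le> (\<eta> / B) * sqrt s" .
  have "5 \<le> \<eta> * L / B" using assms by (simp add: field_simps)
  then have "5 * s \<le> \<eta> * L / B * s" using assms by (intro mult_right_mono) auto
  then have 2: "(1/B) * (\<eta> * (sqrt s + L * s)) \<ge> (\<eta> / B) * sqrt s + 5 * s"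
    using assms by (simp add: field_simps)
  show ?thesis using 1 2 assms by (intro exI[of _ "1/B"]) auto
qed

text \<open>
  At level \<open>t\<close> the event \<open>\<Psi>\<^sub>1\<^sub>,\<^sub>L(\<bar>S\<bar>/\<eta>) > t\<close> is \<open>\<bar>S\<bar> > \<eta> (sqrt s + L s)\<close> with \<open>s = ln (1 + t)\<close>, whose
  probability is at most \<open>4 exp (- 5 s) = 4 / (1 + t)^5\<close>: a factor 2 from the hypothesis and a factor
  2 from the two tails. The exponent 5 is the one for which this bound integrates to exactly 1.
\<close>

lemma (in prob_space) orlicz_norm_Psi1_le:
  fixes S :: "'a \<Rightarrow> real"
  assumes [measurable]: "S \<in> borel_measurable M"
    and "\<sigma> > 0" "B > 0" "L \<ge> 0" and \<eta>: "\<eta> \<ge> 6 * \<sigma>" "\<eta> * L \<ge> 5 * B"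
    and mgf: "\<And>\<mu>. \<bar>\<mu>\<bar> \<le> 1 / B \<Longrightarrow> (\<integral>\<^sup>+ \<omega>. ennreal (exp (\<mu> * S \<omega>)) \<partial>M) \<le> ennreal (2 * exp (\<mu>\<^sup>2 * \<sigma>\<^sup>2))"
  shows "orlicz_norm (Psi1 L) M S \<le> ennreal \<eta>"
proof (rule orlicz_norm_le)
  show "\<eta> > 0" using assms by linarith
  have g [measurable]: "(\<lambda>x. Psi1 L \<bar>x\<bar>) \<in> borel_measurable borel"
    using Psi1_mono[OF \<open>L \<ge> 0\<close>] by (rule borel_measurable_mono_abs)
  have "(\<lambda>\<omega>. Psi1 L \<bar>S \<omega> / \<eta>\<bar>) \<in> borel_measurable M"
    by (rule measurable_compose[OF _ g]) measurable
  then have meas: "(\<lambda>\<omega>. Psi1 L (\<bar>S \<omega>\<bar> / \<eta>)) \<in> borel_measurable M"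
    using \<open>\<eta> > 0\<close> by simp
  have tail: "emeasure M {\<omega> \<in> space M. t < Psi1 L (\<bar>S \<omega>\<bar> / \<eta>)} \<le> ennreal (4 / (1 + t) ^ 5)"
    if t: "t \<ge> 0" for t
  proof -
    define s where "s = ln (1 + t)"
    define x where "x = \<eta> * (sqrt s + L * s)"
    have "s \<ge> 0" using t by (simp add: s_def)
    then obtain \<mu> where \<mu>: "\<mu> \<ge> 0" "\<mu> \<le> 1 / B" "\<mu>\<^sup>2 * \<sigma>\<^sup>2 - \<mu> * x \<le> - 5 * s"
      using sub_gamma_exponent[OF \<open>\<sigma> > 0\<close> \<open>B > 0\<close> _ \<open>L \<ge> 0\<close> \<eta>] unfolding x_def by blast
    have "emeasure M {\<omega> \<in> space M. t < Psi1 L (\<bar>S \<omega>\<bar> / \<eta>)}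
        \<le> emeasure M {\<omega> \<in> space M. 1 \<le> ennreal (exp (- \<mu> * x)) * ennreal (exp (\<mu> * \<bar>S \<omega>\<bar>))}"
    proof (intro emeasure_mono subsetI)
      fix \<omega> assume \<omega>: "\<omega> \<in> {\<omega> \<in> space M. t < Psi1 L (\<bar>S \<omega>\<bar> / \<eta>)}"
      then have "Psi1_inv L t < \<bar>S \<omega>\<bar> / \<eta>"
        using less_Psi1_iff[OF \<open>L \<ge> 0\<close> _ t] \<open>\<eta> > 0\<close> by simp
      then have "x < \<bar>S \<omega>\<bar>"
        using \<open>\<eta> > 0\<close> by (simp add: x_def s_def Psi1_inv_def field_simps)
      then have "1 \<le> exp (- \<mu> * x + \<mu> * \<bar>S \<omega>\<bar>)"
        using \<mu>(1) by (simp add: mult_left_mono)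
      then show "\<omega> \<in> {\<omega> \<in> space M. 1 \<le> ennreal (exp (- \<mu> * x)) * ennreal (exp (\<mu> * \<bar>S \<omega>\<bar>))}"
        using \<omega> unfolding exp_add by (simp flip: ennreal_mult)
    qed measurable
    also have "\<dots> \<le> ennreal (exp (- \<mu> * x)) * (\<integral>\<^sup>+ \<omega>. ennreal (exp (\<mu> * \<bar>S \<omega>\<bar>)) * indicator (space M) \<omega> \<partial>M)"
      by (rule nn_integral_Markov_inequality) measurable
    also have "(\<integral>\<^sup>+ \<omega>. ennreal (exp (\<mu> * \<bar>S \<omega>\<bar>)) * indicator (space M) \<omega> \<partial>M)
        \<le> (\<integral>\<^sup>+ \<omega>. ennreal (exp (\<mu> * S \<omega>)) + ennreal (exp (- \<mu> * S \<omega>)) \<partial>M)"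
      by (intro nn_integral_mono) (auto simp: abs_if indicator_def)
    also have "\<dots> = (\<integral>\<^sup>+ \<omega>. ennreal (exp (\<mu> * S \<omega>)) \<partial>M) + (\<integral>\<^sup>+ \<omega>. ennreal (exp (- \<mu> * S \<omega>)) \<partial>M)"
      by (intro nn_integral_add) measurable
    also have "\<dots> \<le> ennreal (2 * exp (\<mu>\<^sup>2 * \<sigma>\<^sup>2)) + ennreal (2 * exp ((- \<mu>)\<^sup>2 * \<sigma>\<^sup>2))"
      using \<mu> by (intro add_mono mgf) auto
    also have "\<dots> = ennreal (4 * exp (\<mu>\<^sup>2 * \<sigma>\<^sup>2))"
      by (simp flip: ennreal_plus)
    also have "ennreal (exp (- \<mu> * x)) * \<dots> = ennreal (4 * exp (\<mu>\<^sup>2 * \<sigma>\<^sup>2 - \<mu> * x))"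
      by (simp add: exp_diff exp_minus field_simps flip: ennreal_mult)
    also have "\<dots> \<le> ennreal (4 * exp (- 5 * s))"
      using \<mu>(3) by (intro ennreal_leI) simp
    also have "exp (- 5 * s) = 1 / (1 + t) ^ 5"
      using exp_of_nat_mult[of 5 s] t by (simp add: s_def exp_minus inverse_eq_divide)
    finally show ?thesis by (simp add: mult_left_mono)
  qed
  have "(\<integral>\<^sup>+ \<omega>. ennreal (Psi1 L (\<bar>S \<omega>\<bar> / \<eta>)) \<partial>M)
      = (\<integral>\<^sup>+ t. emeasure M {\<omega> \<in> space M. t < Psi1 L (\<bar>S \<omega>\<bar> / \<eta>)} * indicator {0..} t \<partial>lborel)"
    using sigma_finite_measure_axioms meas by (rule nn_integral_layer_cake)
  also have "\<dots> \<le> (\<integral>\<^sup>+ t. ennreal (4 / (1 + t) ^ 5) * indicator {0..} t \<partial>lborel)"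
    by (intro nn_integral_mono) (auto simp: indicator_def tail)
  also have "\<dots> = 1" by (rule nn_integral_inverse_fifth_power)
  finally show "(\<integral>\<^sup>+ \<omega>. ennreal (Psi1 L (\<bar>S \<omega>\<bar> / \<eta>)) \<partial>M) \<le> 1" .
qed

section \<open>The moment generating function of the sum\<close>

lemma exp_le_quadratic:
  fixes u :: real
  assumes "\<bar>u\<bar> \<le> 1"
  shows "exp u \<le> 1 + u + u\<^sup>2"
proof (cases "u \<ge> 0")
  case True
  then show ?thesis using assms exp_bound by simp
next
  case False
  define x where "x = - u"
  have x: "x \<ge> 0" using False by (simp add: x_def)
  have "(1 - x + x\<^sup>2) * exp x \<ge> (1 - x + x\<^sup>2) * (1 + x + x\<^sup>2 / 2)"
  proof (intro mult_left_mono exp_lower_Taylor_quadratic x)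
    have "1 - x + x\<^sup>2 = (x - 1/2)\<^sup>2 + 3/4" by (simp add: power2_eq_square algebra_simps)
    then show "0 \<le> 1 - x + x\<^sup>2" by simp
  qed
  moreover have "(1 - x + x\<^sup>2) * (1 + x + x\<^sup>2 / 2) = 1 + (x^2 + x^3 + x^4) / 2"
    by (simp add: field_simps eval_nat_numeral)
  moreover have "\<dots> \<ge> 1" using x by simp
  ultimately have "1 \<le> (1 - x + x\<^sup>2) * exp x" by linarith
  then show ?thesis by (simp add: x_def exp_minus field_simps)
qed

text \<open>
  For \<open>\<bar>u\<bar> > 1\<close> the scaled variable \<open>z = y / l powr (1/\<alpha>)\<close> exceeds 1, so \<open>z \<le> z powr \<alpha>\<close>; this is where
  \<open>\<alpha> \<ge> 1\<close> enters. As \<open>y powr \<alpha> = l * z powr \<alpha>\<close>, replacing \<open>z powr \<alpha>\<close> by \<open>y powr \<alpha>\<close> gains the factor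
  \<open>exp (l - 1)\<close>.
\<close>

lemma exp_le_quadratic_plus_tail:
  fixes u y :: real
  assumes "\<alpha> \<ge> 1" "y \<ge> 0" "l \<ge> 1" and u: "\<bar>u\<bar> \<le> y / l powr (1 / \<alpha>)"
  shows "exp u \<le> 1 + u + u\<^sup>2 + exp (1 - l) * exp (y powr \<alpha>)"
proof (cases "\<bar>u\<bar> \<le> 1")
  case True
  then show ?thesis using exp_le_quadratic[of u] by (smt (verit) exp_gt_zero mult_pos_pos)
next
  case False
  define z where "z = y / l powr (1 / \<alpha>)"
  have z: "z > 1" "\<bar>u\<bar> \<le> z" using False u by (auto simp: z_def)
  have "z powr \<alpha> = y powr \<alpha> / l"
    using assms by (simp add: z_def powr_divide powr_powr)
  then have zy: "y powr \<alpha> = l * z powr \<alpha>" using assms by (simp add: field_simps)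
  have "z powr 1 \<le> z powr \<alpha>" using z assms by (intro powr_mono) auto
  then have z': "z \<le> z powr \<alpha>" using z by simp
  have "(l - 1) * 1 \<le> (l - 1) * z powr \<alpha>" using assms z z' by (intro mult_left_mono) auto
  then have "z powr \<alpha> \<le> 1 - l + y powr \<alpha>" using zy by (simp add: algebra_simps)
  then have "exp u \<le> exp (1 - l + y powr \<alpha>)" using z z' by simp
  moreover have "0 \<le> 1 + u + u\<^sup>2"
  proof -
    have "1 + u + u\<^sup>2 = (u + 1/2)\<^sup>2 + 3/4" by (simp add: power2_eq_square algebra_simps)
    then show ?thesis by simp
  qed
  ultimately show ?thesis by (simp add: exp_add)
qed

text \<open>
  This turns control of the \<open>\<psi>\<^sub>\<alpha>\<close>-norm into integrability of the square and a bound on the second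
  moment. The summand 1 covers \<open>y \<le> 1\<close>, where \<open>y powr \<alpha>\<close> may be much smaller than \<open>y\<close>.
\<close>

lemma square_le_psi:
  assumes "\<alpha> \<ge> 1" "y \<ge> 0"
  shows "y\<^sup>2 \<le> 1 + 2 * psi \<alpha> y"
proof (cases "y \<le> 1")
  case True
  then have "y\<^sup>2 \<le> 1" using assms by (simp add: power_le_one)
  moreover have "psi \<alpha> y \<ge> 0" by (simp add: psi_def)
  ultimately show ?thesis by linarith
next
  case False
  have "y powr 1 \<le> y powr \<alpha>" using False assms by (intro powr_mono) auto
  then have "exp y \<le> exp (y powr \<alpha>)" using False by simp
  then show ?thesis using exp_lower_Taylor_quadratic[OF assms(2)] assms(2)
    unfolding psi_def right_diff_distrib by linarith
qed

lemma (in prob_space)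
  assumes "\<alpha> \<ge> 1" and [measurable]: "X \<in> borel_measurable M" and K: "orlicz_norm (psi \<alpha>) M X < ennreal K"
  shows integrable_exp_powr_of_orlicz: "integrable M (\<lambda>\<omega>. exp ((\<bar>X \<omega>\<bar> / K) powr \<alpha>))"
    and expectation_exp_powr_le_2: "expectation (\<lambda>\<omega>. exp ((\<bar>X \<omega>\<bar> / K) powr \<alpha>)) \<le> 2"
    and integrable_square_of_orlicz: "integrable M (\<lambda>\<omega>. (X \<omega>)\<^sup>2)"
    and second_moment_le_orlicz: "expectation (\<lambda>\<omega>. (X \<omega>)\<^sup>2) \<le> 3 * K\<^sup>2"
proof -
  have "K > 0" using K by (metis ennreal_eq_0_iff not_less not_less_zero)
  let ?p = "\<lambda>\<omega>. psi \<alpha> (\<bar>X \<omega>\<bar> / K)"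
  have p: "(\<integral>\<^sup>+ \<omega>. ennreal (?p \<omega>) \<partial>M) \<le> 1"
    using K psi_mono assms(1) by (intro nn_integral_le_1_of_orlicz_norm_less) auto
  have p0: "?p \<omega> \<ge> 0" for \<omega> by (simp add: psi_def)
  have [measurable]: "?p \<in> borel_measurable M" unfolding psi_def by measurable
  have ip: "integrable M ?p"
    using p p0 by (intro integrableI_nonneg) (auto simp: less_top[symmetric] top_unique)
  have ep: "expectation ?p \<le> 1"
    using p p0 ip by (simp add: nn_integral_eq_integral)
  have eq: "exp ((\<bar>X \<omega>\<bar> / K) powr \<alpha>) = 1 + ?p \<omega>" for \<omega> by (simp add: psi_def)
  show "integrable M (\<lambda>\<omega>. exp ((\<bar>X \<omega>\<bar> / K) powr \<alpha>))" using ip by (simp add: eq)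
  show "expectation (\<lambda>\<omega>. exp ((\<bar>X \<omega>\<bar> / K) powr \<alpha>)) \<le> 2"
    using ip ep by (simp add: eq prob_space)
  have sq: "(X \<omega>)\<^sup>2 \<le> K\<^sup>2 * (1 + 2 * ?p \<omega>)" for \<omega>
  proof -
    have "(X \<omega>)\<^sup>2 = K\<^sup>2 * (\<bar>X \<omega>\<bar> / K)\<^sup>2" using \<open>K > 0\<close> by (simp add: power_divide)
    also have "\<dots> \<le> K\<^sup>2 * (1 + 2 * ?p \<omega>)"
      using assms(1) \<open>K > 0\<close> by (intro mult_left_mono square_le_psi) auto
    finally show ?thesis .
  qed
  show i2: "integrable M (\<lambda>\<omega>. (X \<omega>)\<^sup>2)"
  proof (rule Bochner_Integration.integrable_bound)
    show "integrable M (\<lambda>\<omega>. K\<^sup>2 * (1 + 2 * ?p \<omega>))" using ip by auto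
    show "AE \<omega> in M. norm ((X \<omega>)\<^sup>2) \<le> norm (K\<^sup>2 * (1 + 2 * ?p \<omega>))"
      using sq by (intro AE_I2) (simp add: order_trans[OF _ abs_ge_self])
  qed measurable
  have "expectation (\<lambda>\<omega>. (X \<omega>)\<^sup>2) \<le> expectation (\<lambda>\<omega>. K\<^sup>2 * (1 + 2 * ?p \<omega>))"
    using ip i2 sq by (intro integral_mono) auto
  also have "\<dots> = K\<^sup>2 * (1 + 2 * expectation ?p)" using ip by (simp add: prob_space)
  also have "\<dots> \<le> K\<^sup>2 * 3" using ep by (intro mult_left_mono) auto
  finally show "expectation (\<lambda>\<omega>. (X \<omega>)\<^sup>2) \<le> 3 * K\<^sup>2" by simp
qed

text \<open>
  The pointwise bound is integrated; the linear term vanishes because the mean is zero.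
\<close>

lemma (in prob_space) mgf_le:
  assumes "\<alpha> \<ge> 1" and X: "integrable M X" "expectation X = 0"
    and K: "orlicz_norm (psi \<alpha>) M X < ennreal K" and l: "l \<ge> 1"
    and \<mu>: "\<bar>\<mu>\<bar> * (K * l powr (1 / \<alpha>)) \<le> 1"
  shows "(\<integral>\<^sup>+ \<omega>. ennreal (exp (\<mu> * X \<omega>)) \<partial>M)
       \<le> ennreal (exp (\<mu>\<^sup>2 * expectation (\<lambda>\<omega>. (X \<omega>)\<^sup>2) + 2 * exp (1 - l)))"
proof -
  have "K > 0" using K by (metis ennreal_eq_0_iff not_less not_less_zero)
  note [measurable] = borel_measurable_integrable[OF X(1)]
  note int = X(1) integrable_exp_powr_of_orlicz[OF assms(1) _ K] integrable_square_of_orlicz[OF assms(1) _ K]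
  let ?h = "\<lambda>\<omega>. 1 + \<mu> * X \<omega> + \<mu>\<^sup>2 * (X \<omega>)\<^sup>2 + exp (1 - l) * exp ((\<bar>X \<omega>\<bar> / K) powr \<alpha>)"
  have h: "exp (\<mu> * X \<omega>) \<le> ?h \<omega>" for \<omega>
  proof -
    have "\<bar>\<mu>\<bar> * (K * l powr (1 / \<alpha>)) * \<bar>X \<omega>\<bar> \<le> 1 * \<bar>X \<omega>\<bar>"
      using \<mu> by (intro mult_right_mono) auto
    then have "\<bar>\<mu> * X \<omega>\<bar> \<le> (\<bar>X \<omega>\<bar> / K) / l powr (1 / \<alpha>)"
      using \<open>K > 0\<close> l by (simp add: abs_mult field_simps)
    from exp_le_quadratic_plus_tail[OF assms(1) _ l this] show ?thesis
      using \<open>K > 0\<close> by (simp add: power_mult_distrib)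
  qed
  have "(\<integral>\<^sup>+ \<omega>. ennreal (exp (\<mu> * X \<omega>)) \<partial>M) \<le> (\<integral>\<^sup>+ \<omega>. ennreal (?h \<omega>) \<partial>M)"
    by (intro nn_integral_mono ennreal_leI h)
  also have "\<dots> = ennreal (expectation ?h)"
    using int h by (intro nn_integral_eq_integral) (auto intro: order_trans[OF less_imp_le[OF exp_gt_zero]])
  also have "expectation ?h = 1 + \<mu>\<^sup>2 * expectation (\<lambda>\<omega>. (X \<omega>)\<^sup>2)
      + exp (1 - l) * expectation (\<lambda>\<omega>. exp ((\<bar>X \<omega>\<bar> / K) powr \<alpha>))"
    using int X(2) by (simp add: prob_space)
  also have "\<dots> \<le> 1 + (\<mu>\<^sup>2 * expectation (\<lambda>\<omega>. (X \<omega>)\<^sup>2) + 2 * exp (1 - l))"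
    using expectation_exp_powr_le_2[OF assms(1) _ K] by (simp add: mult.commute[of 2])
  also have "\<dots> \<le> exp (\<mu>\<^sup>2 * expectation (\<lambda>\<omega>. (X \<omega>)\<^sup>2) + 2 * exp (1 - l))"
    by (rule exp_ge_add_one_self)
  finally show ?thesis by (simp add: ennreal_leI)
qed

text \<open>
  The choice \<open>l = 8 * ln (n + 1)\<close> makes the tail contribution of one summand of order \<open>(n + 1)^(-8)\<close>,
  so that of all \<open>n\<close> summands is uniformly small.
\<close>

lemma tail_total_le:
  assumes "n \<ge> 1"
  shows "exp (real n * (2 * exp (1 - 8 * ln (real n + 1)))) \<le> 2"
proof -
  let ?m = "real n + 1"
  have "exp (8 * ln ?m) = ?m ^ 8" using exp_of_nat_mult[of 8 "ln ?m"] by simp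
  then have "real n * (2 * exp (1 - 8 * ln ?m)) = 2 * exp 1 * (real n / ?m ^ 8)"
    by (simp add: exp_diff)
  also have "\<dots> \<le> 2 * 3 * (1 / 128)"
  proof (intro mult_mono order_refl)
    show "exp 1 \<le> (3::real)" by (rule exp_le)
    have "(2::real) ^ 7 \<le> ?m ^ 7" using assms by (intro power_mono) auto
    then have "real n * 128 \<le> ?m * ?m ^ 7" by (intro mult_mono) auto
    also have "\<dots> = ?m ^ 8" by (simp add: eval_nat_numeral)
    finally show "real n / ?m ^ 8 \<le> 1 / 128" by (simp add: field_simps)
  qed auto
  also have "\<dots> \<le> 1 / 2" by simp
  finally have *: "real n * (2 * exp (1 - 8 * ln ?m)) \<le> 1 / 2" .
  have "exp (real n * (2 * exp (1 - 8 * ln ?m))) \<le> exp (1 / 2)" using * by simp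
  also have "\<dots> \<le> 2" using exp_half_le2 by simp
  finally show ?thesis .
qed

lemma (in prob_space) mgf_sum_le:
  assumes "\<alpha> \<ge> 1" "n \<ge> 1" and indep: "indep_vars (\<lambda>_. borel) X {1..n}"
    and X: "\<And>i. i \<in> {1..n} \<Longrightarrow> integrable M (X i)" "\<And>i. i \<in> {1..n} \<Longrightarrow> expectation (X i) = 0"
    and K: "\<And>i. i \<in> {1..n} \<Longrightarrow> orlicz_norm (psi \<alpha>) M (X i) < ennreal K"
    and \<mu>: "\<bar>\<mu>\<bar> * (K * (8 * ln (real n + 1)) powr (1 / \<alpha>)) \<le> 1"
  shows "(\<integral>\<^sup>+ \<omega>. ennreal (exp (\<mu> * (\<Sum>i=1..n. X i \<omega>))) \<partial>M)
       \<le> ennreal (2 * exp (\<mu>\<^sup>2 * (\<Sum>i=1..n. expectation (\<lambda>\<omega>. (X i \<omega>)\<^sup>2))))"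
proof -
  define l where "l = 8 * ln (real n + 1)"
  have "exp (1 / 2) \<le> real n + 1" using exp_half_le2 assms(2) by linarith
  then have "1 / 2 \<le> ln (real n + 1)" using assms(2) by (subst ln_ge_iff) auto
  then have l: "l \<ge> 1" unfolding l_def by linarith
  let ?V = "\<lambda>i. expectation (\<lambda>\<omega>. (X i \<omega>)\<^sup>2)"
  have "(\<integral>\<^sup>+ \<omega>. ennreal (exp (\<mu> * (\<Sum>i=1..n. X i \<omega>))) \<partial>M)
      = (\<integral>\<^sup>+ \<omega>. (\<Prod>i=1..n. ennreal (exp (\<mu> * X i \<omega>))) \<partial>M)"
    by (simp add: sum_distrib_left exp_sum prod_ennreal)
  also have "\<dots> = (\<Prod>i=1..n. \<integral>\<^sup>+ \<omega>. ennreal (exp (\<mu> * X i \<omega>)) \<partial>M)"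
    by (intro indep_vars_nn_integral indep_vars_compose2[OF indep]) auto
  also have "\<dots> \<le> (\<Prod>i=1..n. ennreal (exp (\<mu>\<^sup>2 * ?V i + 2 * exp (1 - l))))"
    using X K \<mu> l unfolding l_def[symmetric]
    by (intro prod_mono_ennreal mgf_le[OF assms(1), where K = K]) auto
  also have "\<dots> = ennreal (exp (\<Sum>i=1..n. \<mu>\<^sup>2 * ?V i + 2 * exp (1 - l)))"
    by (simp add: prod_ennreal exp_sum)
  also have "(\<Sum>i=1..n. \<mu>\<^sup>2 * ?V i + 2 * exp (1 - l)) = \<mu>\<^sup>2 * (\<Sum>i=1..n. ?V i) + real n * (2 * exp (1 - l))"
    by (simp add: sum.distrib sum_distrib_left)
  also have "exp \<dots> \<le> exp (\<mu>\<^sup>2 * (\<Sum>i=1..n. ?V i)) * 2"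
    unfolding exp_add using tail_total_le[OF assms(2)] by (intro mult_left_mono) (auto simp: l_def)
  finally show ?thesis by (simp add: mult.commute ennreal_leI)
qed

section \<open>An admissible constant\<close>

text \<open>
  A variable with vanishing norm has vanishing second moment, because the second moment is at most
  three times the square of any larger scale.
\<close>

lemma Max_enn2real_orlicz_pos:
  fixes n :: nat
  assumes "prob_space M" "\<alpha> \<ge> 1"
    and X: "\<And>i. i \<in> {1..n} \<Longrightarrow> X i \<in> borel_measurable M"
      "\<And>i. i \<in> {1..n} \<Longrightarrow> orlicz_norm (psi \<alpha>) M (X i) < \<infinity>"
    and V: "(\<Sum>i = 1..n. \<integral>\<omega>. (X i \<omega>)\<^sup>2 \<partial>M) > 0"
  shows "(MAX i \<in> {1..n}. enn2real (orlicz_norm (psi \<alpha>) M (X i))) > 0"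
proof -
  interpret prob_space M by fact
  obtain i where i: "i \<in> {1..n}" "(\<integral>\<omega>. (X i \<omega>)\<^sup>2 \<partial>M) > 0"
    using V by (meson not_less sum_nonpos)
  let ?v = "\<integral>\<omega>. (X i \<omega>)\<^sup>2 \<partial>M"
  have "\<not> orlicz_norm (psi \<alpha>) M (X i) < ennreal (sqrt (?v / 4))"
    using second_moment_le_orlicz[OF assms(2) X(1)[OF i(1)], of "sqrt (?v / 4)"] i by auto
  then have "orlicz_norm (psi \<alpha>) M (X i) > 0"
    using i by (auto simp: zero_less_iff_neq_zero ennreal_zero_less_divide)
  then have "enn2real (orlicz_norm (psi \<alpha>) M (X i)) > 0"
    using X(2)[OF i(1)] by (simp add: enn2real_positive_iff)
  also have "\<dots> \<le> (MAX i \<in> {1..n}. enn2real (orlicz_norm (psi \<alpha>) M (X i)))"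
    using i by (intro Max_ge) auto
  finally show ?thesis .
qed

lemma L_const_nonneg:
  assumes "C \<ge> 0" "n \<ge> 1"
  shows "L_const \<alpha> C M n X \<ge> 0"
proof -
  have "0 \<le> enn2real (orlicz_norm (psi \<alpha>) M (X 1))" by simp
  also have "\<dots> \<le> (MAX i \<in> {1..n}. enn2real (orlicz_norm (psi \<alpha>) M (X i)))"
    using assms by (intro Max_ge) auto
  finally show ?thesis unfolding L_const_def using assms by simp
qed

text \<open>
  The maximal norm is doubled to make it strictly larger than each single norm, which turns the scale
  of the moment generating function into \<open>B = 2 K (8 log (n + 1)) powr (1/\<alpha>)\<close>. The constant is chosen such
  that \<open>L = B / (sqrt 6 * \<sigma>)\<close>; hence \<open>\<eta> L = 2 e B\<close> for the scale \<open>\<eta> = 2 e sqrt 6 \<sigma>\<close> of the claim, and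
  \<open>2 e \<ge> 5\<close> is what the norm bound asks for.
\<close>

lemma admissible_const_explicit:
  assumes \<alpha>: "\<alpha> \<ge> 1"
  shows "admissible_const TYPE('a) \<alpha> (4 * 2 powr (1 / \<alpha>))"
  unfolding admissible_const_def
proof (intro allI impI)
  fix M :: "'a measure" and n :: nat and X :: "nat \<Rightarrow> 'a \<Rightarrow> real"
  assume M: "prob_space M" and indep: "prob_space.indep_vars M (\<lambda>_. borel) X {1..n}"
    and X: "\<forall>i\<in>{1..n}. integrable M (X i) \<and> (\<integral>\<omega>. X i \<omega> \<partial>M) = 0"
    and fin: "\<forall>i\<in>{1..n}. orlicz_norm (psi \<alpha>) M (X i) < \<infinity>"
    and V: "(\<Sum>i = 1..n. \<integral>\<omega>. (X i \<omega>)\<^sup>2 \<partial>M) > 0"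
  interpret prob_space M by fact
  define \<sigma> where "\<sigma> = sqrt (\<Sum>i = 1..n. \<integral>\<omega>. (X i \<omega>)\<^sup>2 \<partial>M)"
  define K where "K = (MAX i \<in> {1..n}. enn2real (orlicz_norm (psi \<alpha>) M (X i)))"
  define L where "L = L_const \<alpha> (4 * 2 powr (1 / \<alpha>)) M n X"
  define B where "B = 2 * K * (8 * ln (real n + 1)) powr (1 / \<alpha>)"
  have n: "n \<ge> 1" using V by (cases n) auto
  have "\<sigma> > 0" using V by (simp add: \<sigma>_def)
  have "K > 0" unfolding K_def using M \<alpha> X fin V by (intro Max_enn2real_orlicz_pos) auto
  have "ln (real n + 1) > 0" using n by simp
  then have "B > 0" using \<open>K > 0\<close> by (simp add: B_def)
  have "L \<ge> 0" unfolding L_def using n by (intro L_const_nonneg) auto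
  have "4 powr (1 / \<alpha>) * 2 powr (1 / \<alpha>) * ln (real n + 1) powr (1 / \<alpha>) = (8 * ln (real n + 1)) powr (1 / \<alpha>)"
    using \<open>ln (real n + 1) > 0\<close> by (simp flip: powr_mult)
  moreover have "(\<Sum>i = 1..n. \<integral>\<omega>. (X i \<omega>)\<^sup>2 \<partial>M) powr (- 1 / 2) = 1 / \<sigma>"
    using V by (simp add: \<sigma>_def powr_minus powr_half_sqrt inverse_eq_divide)
  ultimately have L: "L = B / (sqrt 6 * \<sigma>)"
    unfolding L_def L_const_def B_def K_def[symmetric] by (simp add: field_simps)
  show "orlicz_norm (Psi1 (L_const \<alpha> (4 * 2 powr (1 / \<alpha>)) M n X)) M (\<lambda>\<omega>. \<Sum>i = 1..n. X i \<omega>)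
      \<le> ennreal (2 * exp 1 * sqrt 6 * sqrt (\<Sum>i = 1..n. \<integral>\<omega>. (X i \<omega>)\<^sup>2 \<partial>M))"
    unfolding L_def[symmetric] \<sigma>_def[symmetric]
  proof (rule orlicz_norm_Psi1_le[OF _ \<open>\<sigma> > 0\<close> \<open>B > 0\<close> \<open>L \<ge> 0\<close>])
    show "(\<lambda>\<omega>. \<Sum>i = 1..n. X i \<omega>) \<in> borel_measurable M"
      using X by (intro borel_measurable_sum) auto
    have "2 * (5 / 2) * 2 \<le> 2 * exp 1 * sqrt 6"
      using exp_1_ge by (intro mult_mono) (auto intro: real_le_rsqrt)
    then show "6 * \<sigma> \<le> 2 * exp 1 * sqrt 6 * \<sigma>" using \<open>\<sigma> > 0\<close> by (intro mult_right_mono) auto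
    have "5 * B \<le> 2 * exp 1 * B" using exp_1_ge \<open>B > 0\<close> by (intro mult_right_mono) auto
    then show "5 * B \<le> 2 * exp 1 * sqrt 6 * \<sigma> * L" using \<open>\<sigma> > 0\<close> by (simp add: L)
    fix \<mu> :: real assume \<mu>: "\<bar>\<mu>\<bar> \<le> 1 / B"
    have "(\<integral>\<^sup>+ \<omega>. ennreal (exp (\<mu> * (\<Sum>i=1..n. X i \<omega>))) \<partial>M)
       \<le> ennreal (2 * exp (\<mu>\<^sup>2 * (\<Sum>i=1..n. expectation (\<lambda>\<omega>. (X i \<omega>)\<^sup>2))))"
    proof (rule mgf_sum_le[OF \<alpha> n indep, where K = "2 * K"])
      fix i assume i: "i \<in> {1..n}"
      have "orlicz_norm (psi \<alpha>) M (X i) = ennreal (enn2real (orlicz_norm (psi \<alpha>) M (X i)))"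
        using fin i by simp
      also have "\<dots> \<le> ennreal K"
        unfolding K_def using i by (intro ennreal_leI Max_ge) auto
      also have "\<dots> < ennreal (2 * K)" using \<open>K > 0\<close> by (simp add: ennreal_less_iff)
      finally show "orlicz_norm (psi \<alpha>) M (X i) < ennreal (2 * K)" .
    next
      show "\<bar>\<mu>\<bar> * (2 * K * (8 * ln (real n + 1)) powr (1 / \<alpha>)) \<le> 1"
        using \<mu> \<open>B > 0\<close> unfolding B_def[symmetric] by (simp add: field_simps)
    qed (use X in auto)
    also have "(\<Sum>i=1..n. expectation (\<lambda>\<omega>. (X i \<omega>)\<^sup>2)) = \<sigma>\<^sup>2"
      using V by (simp add: \<sigma>_def)
    finally show "(\<integral>\<^sup>+ \<omega>. ennreal (exp (\<mu> * (\<Sum>i=1..n. X i \<omega>))) \<partial>M) \<le> ennreal (2 * exp (\<mu>\<^sup>2 * \<sigma>\<^sup>2))" .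
  qed
qed

section \<open>Independence of the sample space\<close>

text \<open>
  Independence says that the joint law is the product of the marginals, and both are unchanged when
  the sample space is replaced by its image under \<open>F\<close>.
\<close>

lemma (in prob_space) indep_vars_coordinates_of_joint_law:
  assumes indep: "indep_vars (\<lambda>_. borel) X I" and "I \<noteq> {}"
    and F [measurable]: "F \<in> measurable M N" and coord [measurable]: "\<And>i. i \<in> I \<Longrightarrow> Y i \<in> borel_measurable N"
    and X: "\<And>i \<omega>. i \<in> I \<Longrightarrow> Y i (F \<omega>) = (X i \<omega> :: real)"
  shows "prob_space.indep_vars (distr M N F) (\<lambda>_. borel) Y I"
proof -
  interpret N: prob_space "distr M N F" by (rule prob_space_distr) fact
  have rv: "\<And>i. i \<in> I \<Longrightarrow> X i \<in> borel_measurable M"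
    using indep by (auto simp: indep_vars_def)
  have "distr (distr M N F) (\<Pi>\<^sub>M i\<in>I. borel) (\<lambda>x. \<lambda>i\<in>I. Y i x)
      = distr M (\<Pi>\<^sub>M i\<in>I. borel) (\<lambda>\<omega>. \<lambda>i\<in>I. X i \<omega>)"
    by (subst distr_distr) (auto simp: comp_def X intro!: distr_cong restrict_ext measurable_restrict)
  also have "\<dots> = (\<Pi>\<^sub>M i\<in>I. distr M borel (X i))"
    using indep indep_vars_iff_distr_eq_PiM'[OF \<open>I \<noteq> {}\<close> rv] by simp
  also have "\<dots> = (\<Pi>\<^sub>M i\<in>I. distr (distr M N F) borel (Y i))"
    by (intro PiM_cong refl) (subst distr_distr, auto simp: comp_def X intro!: distr_cong)
  finally show ?thesis
    using N.indep_vars_iff_distr_eq_PiM'[OF \<open>I \<noteq> {}\<close>, of Y "\<lambda>_. borel"] coord by simp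
qed

text \<open>
  The law of \<open>(X\<^sub>1, \<dots>, X\<^sub>n, 0, 0, \<dots>)\<close> is a probability measure on sequences whose coordinates have all
  the properties of the \<open>X\<^sub>i\<close>. Padding with zeros makes the map into sequences measurable, as the
  family \<open>X\<close> is arbitrary outside \<open>{1..n}\<close>.
\<close>

lemma admissible_const_transfer:
  assumes \<alpha>: "\<alpha> \<ge> 1" and "C > 0" and adm: "admissible_const TYPE(nat \<Rightarrow> real) \<alpha> C"
  shows "admissible_const TYPE('a) \<alpha> C"
  unfolding admissible_const_def
proof (intro allI impI)
  fix M :: "'a measure" and n :: nat and X :: "nat \<Rightarrow> 'a \<Rightarrow> real"
  assume M: "prob_space M" and indep: "prob_space.indep_vars M (\<lambda>_. borel) X {1..n}"
    and X: "\<forall>i\<in>{1..n}. integrable M (X i) \<and> (\<integral>\<omega>. X i \<omega> \<partial>M) = 0"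
    and fin: "\<forall>i\<in>{1..n}. orlicz_norm (psi \<alpha>) M (X i) < \<infinity>"
    and V: "(\<Sum>i = 1..n. \<integral>\<omega>. (X i \<omega>)\<^sup>2 \<partial>M) > 0"
  interpret prob_space M by fact
  have n: "n \<ge> 1" using V by (cases n) auto
  define P where "P = (\<Pi>\<^sub>M i\<in>(UNIV::nat set). (borel :: real measure))"
  define F where "F \<omega> i = (if i \<in> {1..n} then X i \<omega> else 0)" for \<omega> i
  define N where "N = distr M P F"
  define Y where "Y i x = x i" for i :: nat and x :: "nat \<Rightarrow> real"
  have F [measurable]: "F \<in> measurable M P"
    unfolding P_def
  proof (intro measurable_PiM_single')
    show "(\<lambda>\<omega>. F \<omega> i) \<in> borel_measurable M" for i
      using X by (cases "i \<in> {1..n}") (auto simp: F_def)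
  qed auto
  have Y [measurable]: "Y i \<in> borel_measurable P" for i
    unfolding P_def Y_def by (rule measurable_component_singleton) simp
  have YF: "Y i (F \<omega>) = X i \<omega>" if "i \<in> {1..n}" for i \<omega>
    using that by (simp add: F_def Y_def)
  have N: "prob_space N" unfolding N_def by (rule prob_space_distr) fact
  have indepY: "prob_space.indep_vars N (\<lambda>_. borel) Y {1..n}"
    unfolding N_def using n by (intro indep_vars_coordinates_of_joint_law[OF indep]) (auto simp: YF)
  have meanY: "integrable N (Y i) \<and> (\<integral>x. Y i x \<partial>N) = 0" if "i \<in> {1..n}" for i
    using X that unfolding N_def by (simp add: integrable_distr_eq integral_distr YF)
  have sqY: "(\<integral>x. (Y i x)\<^sup>2 \<partial>N) = (\<integral>\<omega>. (X i \<omega>)\<^sup>2 \<partial>M)" if "i \<in> {1..n}" for i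
    using that unfolding N_def by (simp add: integral_distr YF)
  have psiY: "orlicz_norm (psi \<alpha>) N (Y i) = orlicz_norm (psi \<alpha>) M (X i)" if "i \<in> {1..n}" for i
    unfolding N_def using that \<alpha> psi_mono
    by (subst orlicz_norm_distr) (auto simp: YF intro!: borel_measurable_mono_abs)
  have L: "L_const \<alpha> C N n Y = L_const \<alpha> C M n X"
    unfolding L_const_def by (simp add: sqY psiY cong: image_cong_simp)
  have L0: "L_const \<alpha> C M n X \<ge> 0" using \<open>C > 0\<close> n by (intro L_const_nonneg) auto
  have sumY: "(\<Sum>i = 1..n. \<integral>x. (Y i x)\<^sup>2 \<partial>N) = (\<Sum>i = 1..n. \<integral>\<omega>. (X i \<omega>)\<^sup>2 \<partial>M)"
    by (intro sum.cong sqY) auto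
  have "orlicz_norm (Psi1 (L_const \<alpha> C N n Y)) N (\<lambda>x. \<Sum>i = 1..n. Y i x)
      \<le> ennreal (2 * exp 1 * sqrt 6 * sqrt (\<Sum>i = 1..n. \<integral>x. (Y i x)\<^sup>2 \<partial>N))"
    using fin V by (intro adm[unfolded admissible_const_def, rule_format, OF N indepY])
      (simp_all only: meanY psiY sumY simp_thms)
  also have "orlicz_norm (Psi1 (L_const \<alpha> C N n Y)) N (\<lambda>x. \<Sum>i = 1..n. Y i x)
      = orlicz_norm (Psi1 (L_const \<alpha> C M n X)) M (\<lambda>\<omega>. \<Sum>i = 1..n. Y i (F \<omega>))"
    unfolding L unfolding N_def
    by (rule orlicz_norm_distr)
       (auto intro!: borel_measurable_mono_abs Psi1_mono[OF L0])
  also have "(\<lambda>\<omega>. \<Sum>i = 1..n. Y i (F \<omega>)) = (\<lambda>\<omega>. \<Sum>i = 1..n. X i \<omega>)"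
    by (intro ext sum.cong YF) auto
  finally show "orlicz_norm (Psi1 (L_const \<alpha> C M n X)) M (\<lambda>\<omega>. \<Sum>i = 1..n. X i \<omega>)
      \<le> ennreal (2 * exp 1 * sqrt 6 * sqrt (\<Sum>i = 1..n. \<integral>\<omega>. (X i \<omega>)\<^sup>2 \<partial>M))"
    unfolding sumY .
qed

theorem theorem3p3:
  fixes \<alpha> :: real
  assumes "\<alpha> \<ge> 1"
  shows "(\<exists>C>0. admissible_const TYPE(nat \<Rightarrow> real) \<alpha> C) \<and>
         (\<forall>C>0. admissible_const TYPE(nat \<Rightarrow> real) \<alpha> C \<longrightarrow> admissible_const TYPE('a) \<alpha> C)"
proof (intro conjI allI impI)
  show "\<exists>C>0. admissible_const TYPE(nat \<Rightarrow> real) \<alpha> C"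
    using admissible_const_explicit[OF assms] by (intro exI[of _ "4 * 2 powr (1 / \<alpha>)"]) simp
  show "admissible_const TYPE('a) \<alpha> C"
    if "C > 0" "admissible_const TYPE(nat \<Rightarrow> real) \<alpha> C" for C
    using assms that by (rule admissible_const_transfer)
qed

end
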